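(* Let $R,T\ge1$ and let $\mathbf{W}=\sum_{r=1}^{R}\mathbf{W}_r$, where $\mathbf{W}_1,\dots,\mathbf{W}_R$ are independent $T\times T$ complex Wishart matrices, each with one degree of freedom, $\mathbf{W}_r$ having diagonal covariance matrix $\mathbf{\Sigma}_r$. Then for every $n\ge1$ the matrix-valued moment $\mathbf{E}[\mathbf{W}^n]$ is a diagonal matrix, and $$\mathbf{E}[\mathbf{W}^n]=\mathbf{K}_n[\mathbf{W}]+\sum_{\ell=1}^{n-1}\binom{n-1}{\ell-1}\mathbf{K}_\ell[\mathbf{W}]\,\mathbf{E}[\mathbf{W}^{n-\ell}].$$
   Context: A $T\times T$ complex Wishart matrix with one degree of freedom and diagonal covariance $\mathbf{\Sigma}_r$ (a real diagonal matrix with nonnegative diagonal entries) is $\mathbf{W}_r=\mathbf{\Sigma}_r^{1/2}\mathbf{h}_r\mathbf{h}_r^{*}\mathbf{\Sigma}_r^{1/2}$, where $\mathbf{h}_r\in\mathbb{C}^{T}$ has i.i.d. zero-mean unit-variance circularly symmetric complex Gaussian entries and $^{*}$ is the conjugate transpose; the vectors $\mathbf{h}_1,\dots,\mathbf{h}_R$ are independent. For a random Hermitian $T\times T$ matrix $\mathbf{X}$ with all moments finite, $\mathbf{E}[\mathbf{X}^n]$ denotes the entrywise expectation of the matrix power $\mathbf{X}^n$. Put $\mathbf{\Phi}_{\mathbf{X}}(t)=\mathbf{E}[e^{\mathrm{i}t\mathbf{X}}]$ (matrix exponential) and, for real $t$ near $0$, $\mathbf{\Psi}_{\mathbf{X}}(t)=\log\mathbf{\Phi}_{\mathbf{X}}(t)$,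 where $\log\mathbf{A}=\sum_{k\ge1}(-1)^{k+1}(\mathbf{A}-\mathbf{I})^k/k$ is the matrix logarithm. The $n$-th order matrix-valued cumulant is $\mathbf{K}_n[\mathbf{X}]=\mathrm{i}^{-n}\,\frac{d^n}{dt^n}\mathbf{\Psi}_{\mathbf{X}}(t)\big|_{t=0}$. *)

theory Defs
  imports "HOL-Probability.Probability"
begin

text \<open>Random vectors and matrices have type \<open>complex ^ 't\<close> and \<open>complex ^ 't ^ 't\<close>,
  where \<open>CARD('t)\<close> is the dimension. All matrix products are \<open>**\<close>: the class
  operations \<open>*\<close> and \<open>^\<close> on these types act entrywise.\<close>

definition diagonal_matrix :: "'a::zero ^ 'n ^ 'n \<Rightarrow> bool" where
  "diagonal_matrix A \<longleftrightarrow> (\<forall>i j. i \<noteq> j \<longrightarrow> A $ i $ j = 0)"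

definition hermitian_transpose :: "complex ^ 'n ^ 'm \<Rightarrow> complex ^ 'm ^ 'n" where
  "hermitian_transpose A = transpose (map_matrix cnj A)"

definition matrix_scale :: "'a::times \<Rightarrow> 'a ^ 'n ^ 'm \<Rightarrow> 'a ^ 'n ^ 'm" where
  "matrix_scale c A = map_matrix (\<lambda>x. c * x) A"

primrec matrix_power :: "'a::semiring_1 ^ 'n ^ 'n \<Rightarrow> nat \<Rightarrow> 'a ^ 'n ^ 'n" where
  "matrix_power A 0 = mat 1"
| "matrix_power A (Suc n) = A ** matrix_power A n"

definition matrix_exp :: "complex ^ 'n ^ 'n \<Rightarrow> complex ^ 'n ^ 'n" where
  "matrix_exp A = (\<Sum>k. (1 / fact k) *\<^sub>R matrix_power A k)"

text \<open>The logarithm series starts at exponent 1, so its \<open>k\<close>-th term (from 0) has exponent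
  \<open>Suc k\<close>. Where the series diverges the value is unspecified.\<close>

definition matrix_log :: "complex ^ 'n ^ 'n \<Rightarrow> complex ^ 'n ^ 'n" where
  "matrix_log A = (\<Sum>k. ((-1) ^ k / real (Suc k)) *\<^sub>R matrix_power (A - mat 1) (Suc k))"

definition matrix_expectation ::
    "'a measure \<Rightarrow> ('a \<Rightarrow> complex ^ 'n ^ 'm) \<Rightarrow> complex ^ 'n ^ 'm" where
  "matrix_expectation M X = (\<chi> i j. \<integral>\<omega>. X \<omega> $ i $ j \<partial>M)"

definition matrix_moment ::
    "'a measure \<Rightarrow> ('a \<Rightarrow> complex ^ 'n ^ 'n) \<Rightarrow> nat \<Rightarrow> complex ^ 'n ^ 'n" where
  "matrix_moment M X n = matrix_expectation M (\<lambda>\<omega>. matrix_power (X \<omega>) n)"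

definition matrix_char ::
    "'a measure \<Rightarrow> ('a \<Rightarrow> complex ^ 'n ^ 'n) \<Rightarrow> real \<Rightarrow> complex ^ 'n ^ 'n" where
  "matrix_char M X t =
     matrix_expectation M (\<lambda>\<omega>. matrix_exp (matrix_scale (\<i> * complex_of_real t) (X \<omega>)))"

definition matrix_log_char ::
    "'a measure \<Rightarrow> ('a \<Rightarrow> complex ^ 'n ^ 'n) \<Rightarrow> real \<Rightarrow> complex ^ 'n ^ 'n" where
  "matrix_log_char M X t = matrix_log (matrix_char M X t)"

definition higher_vector_derivative ::
    "nat \<Rightarrow> (real \<Rightarrow> 'b::real_normed_vector) \<Rightarrow> real \<Rightarrow> 'b" where
  "higher_vector_derivative n f = ((\<lambda>g t. vector_derivative g (at t)) ^^ n) f"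

definition matrix_cumulant ::
    "'a measure \<Rightarrow> ('a \<Rightarrow> complex ^ 'n ^ 'n) \<Rightarrow> nat \<Rightarrow> complex ^ 'n ^ 'n" where
  "matrix_cumulant M X n =
     matrix_scale (inverse (\<i> ^ n)) (higher_vector_derivative n (matrix_log_char M X) 0)"

text \<open>Circular symmetry and \<open>E \<bar>Z\<bar>\<^sup>2 = 1\<close> for a zero-mean complex Gaussian \<open>Z\<close> mean that the
  real and imaginary parts are independent real Gaussians of variance \<open>1/2\<close> each
  (\<open>normal_density\<close> takes the standard deviation).\<close>

definition standard_complex_gaussian :: "'a measure \<Rightarrow> ('a \<Rightarrow> complex) \<Rightarrow> bool" where
  "standard_complex_gaussian M Z \<longleftrightarrow>
     prob_space.indep_var M borel (\<lambda>\<omega>. Re (Z \<omega>)) borel (\<lambda>\<omega>. Im (Z \<omega>)) \<and>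
     distributed M lborel (\<lambda>\<omega>. Re (Z \<omega>)) (\<lambda>x. ennreal (normal_density 0 (sqrt (1/2)) x)) \<and>
     distributed M lborel (\<lambda>\<omega>. Im (Z \<omega>)) (\<lambda>x. ennreal (normal_density 0 (sqrt (1/2)) x))"

definition iid_standard_complex_gaussian :: "'a measure \<Rightarrow> ('a \<Rightarrow> complex ^ 't) \<Rightarrow> bool" where
  "iid_standard_complex_gaussian M h \<longleftrightarrow>
     prob_space.indep_vars M (\<lambda>_. borel) (\<lambda>i \<omega>. h \<omega> $ i) UNIV \<and>
     (\<forall>i. standard_complex_gaussian M (\<lambda>\<omega>. h \<omega> $ i))"

definition diagonal_covariance :: "real ^ 't ^ 't \<Rightarrow> bool" where
  "diagonal_covariance S \<longleftrightarrow> diagonal_matrix S \<and> (\<forall>i. 0 \<le> S $ i $ i)"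

text \<open>The entrywise root is the positive semidefinite square root only for diagonal matrices
  with nonnegative entries, see \<open>diagonal_sqrt\<close> below.\<close>

definition matrix_sqrt_diagonal :: "real ^ 't ^ 't \<Rightarrow> real ^ 't ^ 't" where
  "matrix_sqrt_diagonal S = map_matrix sqrt S"

lemma diagonal_sqrt:
  assumes "diagonal_covariance S"
  shows "diagonal_covariance (matrix_sqrt_diagonal S)"
    and "matrix_sqrt_diagonal S ** matrix_sqrt_diagonal S = S"
proof -
  have d: "S $ i $ j = 0" if "i \<noteq> j" for i j
    using assms that by (simp add: diagonal_covariance_def diagonal_matrix_def)
  have p: "0 \<le> S $ i $ i" for i
    using assms by (simp add: diagonal_covariance_def)
  show "diagonal_covariance (matrix_sqrt_diagonal S)"
    using d p by (simp add: diagonal_covariance_def diagonal_matrix_def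
        matrix_sqrt_diagonal_def map_matrix_def)
  have "(\<Sum>k\<in>UNIV. sqrt (S $ i $ k) * sqrt (S $ k $ j)) = S $ i $ j" for i j
  proof -
    have "(\<Sum>k\<in>UNIV. sqrt (S $ i $ k) * sqrt (S $ k $ j)) =
        (\<Sum>k\<in>UNIV. if k = i then sqrt (S $ i $ i) * sqrt (S $ i $ j) else 0)"
      by (rule sum.cong) (auto simp: d)
    also have "\<dots> = S $ i $ j"
      using d p by (cases "i = j") simp_all
    finally show ?thesis .
  qed
  then show "matrix_sqrt_diagonal S ** matrix_sqrt_diagonal S = S"
    by (simp add: matrix_sqrt_diagonal_def map_matrix_def matrix_matrix_mult_def vec_eq_iff)
qed

text \<open>The value at a sample point of a complex Wishart matrix with one degree of freedom.\<close>

definition wishart1 :: "real ^ 't ^ 't \<Rightarrow> complex ^ 't \<Rightarrow> complex ^ 't ^ 't" where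
  "wishart1 S h =
     (let Q = map_matrix complex_of_real (matrix_sqrt_diagonal S);
          v = (columnvector h :: complex ^ 1 ^ 't)
      in Q ** (v ** hermitian_transpose v) ** Q)"

end

theory Submission
  imports Defs "HOL-Complex_Analysis.Complex_Analysis"
begin

text \<open>The entries of \<open>W\<close> are bounded by a multiple of \<open>\<Sum>r. \<parallel>h r\<parallel>\<^sup>2\<close>, which has an exponential
  moment, so by dominated convergence the entries of the characteristic function are power series
  \<open>\<Sum>k. (\<i>t)\<^sup>k E[W\<^sup>k] / k!\<close> near \<open>0\<close> and extend holomorphically. Negating one coordinate of all
  the \<open>h r\<close> preserves their joint law and conjugates \<open>W\<close> by a diagonal sign matrix, so the
  off-diagonal entries of all moments vanish. Hence the characteristic function is diagonal near
  \<open>0\<close>, its matrix logarithm is the entrywise principal logarithm \<open>g\<close> of its diagonal entries \<open>f\<close>,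
  and the recursion is Leibniz' rule applied to \<open>f' = g' f\<close> at \<open>0\<close>.\<close>

no_notation fps_nth (infixl \<open>$\<close> 75)

section \<open>Entries of matrix powers and of the matrix exponential\<close>

lemma sums_vecI: "(\<And>i. (\<lambda>n. f n $ i) sums (l $ i)) \<Longrightarrow> f sums l"
  unfolding sums_def by (rule vec_tendstoI) simp

lemma matrix_scale_nth [simp]: "matrix_scale c A $ i $ j = c * A $ i $ j"
  by (simp add: matrix_scale_def map_matrix_def)

lemma matrix_power_scale:
  fixes A :: "'a::comm_semiring_1 ^ 'n ^ 'n"
  shows "matrix_power (matrix_scale c A) k = matrix_scale (c ^ k) (matrix_power A k)"
proof (induction k)
  case 0
  show ?case by (simp add: vec_eq_iff)
next
  case (Suc k)
  show ?case
    by (simp add: Suc vec_eq_iff matrix_matrix_mult_def sum_distrib_left mult_ac)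
qed

text \<open>Each entry of a product is a sum of \<open>CARD('n)\<close> terms, so every further
  factor \<open>A\<close> costs at most \<open>CARD('n) * y\<close>.\<close>

lemma norm_matrix_power_nth_le:
  fixes A :: "complex ^ 'n ^ 'n"
  assumes A: "\<And>i j. norm (A $ i $ j) \<le> y"
  shows "norm (matrix_power A k $ i $ j) \<le> (real CARD('n) * y) ^ k"
proof (induction k arbitrary: i j)
  case 0
  show ?case by (simp add: mat_def)
next
  case (Suc k)
  have y: "0 \<le> y"
    using A[of i j] norm_ge_zero order_trans by blast
  have "norm (matrix_power A (Suc k) $ i $ j)
      \<le> (\<Sum>l\<in>UNIV. norm (A $ i $ l) * norm (matrix_power A k $ l $ j))"
    unfolding matrix_power.simps matrix_matrix_mult_def
    by (simp add: norm_mult [symmetric] sum_norm_le)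
  also have "\<dots> \<le> (\<Sum>l\<in>(UNIV :: 'n set). y * (real CARD('n) * y) ^ k)"
    by (intro sum_mono mult_mono A Suc) (use y in auto)
  finally show ?case by simp
qed

lemma sum_power_div_fact_le_exp:
  fixes x :: real
  assumes "0 \<le> x"
  shows "(\<Sum>k<n. x ^ k / fact k) \<le> exp x"
proof -
  have "(\<lambda>k. x ^ k / fact k) sums exp x"
    using exp_converges[of x] by (simp add: divide_inverse mult.commute)
  then show ?thesis
    using assms sum_le_suminf[of "\<lambda>k. x ^ k / fact k" "{..<n}"] by (simp add: sums_iff)
qed

text \<open>One term of the exponential series is at most the whole. This makes all moments finite
  once a single exponential moment is.\<close>

lemma power_le_fact_mult_exp:
  fixes x :: real
  assumes "0 \<le> x"
  shows "x ^ k \<le> fact k * exp x"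
proof -
  have "x ^ k / fact k \<le> (\<Sum>l<Suc k. x ^ l / fact l)"
    by (rule member_le_sum) (use assms in auto)
  also have "\<dots> \<le> exp x"
    by (rule sum_power_div_fact_le_exp) fact
  finally show ?thesis
    by (simp add: divide_simps mult.commute)
qed

text \<open>In each entry the scalar exponential series at \<open>CARD('n) * y\<close> dominates, so
  the \<open>suminf\<close> in \<open>matrix_exp\<close> is a genuine limit and can be read
  entrywise.\<close>

lemma matrix_exp_nth_sums:
  fixes A :: "complex ^ 'n ^ 'n"
  shows "(\<lambda>k. matrix_power A k $ i $ j / fact k) sums (matrix_exp A $ i $ j)"
proof -
  define y where "y = (\<Sum>i\<in>UNIV. \<Sum>j\<in>UNIV. norm (A $ i $ j))"
  have y: "norm (A $ i $ j) \<le> y" for i j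
  proof -
    have "norm (A $ i $ j) \<le> (\<Sum>j\<in>UNIV. norm (A $ i $ j))"
      by (rule member_le_sum) auto
    also have "\<dots> \<le> y"
      unfolding y_def
      by (rule member_le_sum [where f = "\<lambda>i. \<Sum>j\<in>UNIV. norm (A $ i $ j)"]) (auto intro: sum_nonneg)
    finally show ?thesis .
  qed
  have "summable (\<lambda>k. matrix_power A k $ i $ j / fact k)" for i j
  proof (rule summable_comparison_test')
    show "summable (\<lambda>k. (real CARD('n) * y) ^ k / fact k)"
      using summable_exp[of "real CARD('n) * y"] by (simp add: divide_inverse mult.commute)
    show "norm (matrix_power A k $ i $ j / fact k) \<le> (real CARD('n) * y) ^ k / fact k" for k
      using norm_matrix_power_nth_le[OF y] by (simp add: norm_divide divide_right_mono)
  qed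
  then have *: "(\<lambda>k. matrix_power A k $ i $ j / fact k) sums (\<Sum>k. matrix_power A k $ i $ j / fact k)" for i j
    by (rule summable_sums)
  have "(\<lambda>k. (1 / fact k) *\<^sub>R matrix_power A k) sums (\<chi> i j. \<Sum>k. matrix_power A k $ i $ j / fact k)"
    by (intro sums_vecI) (use * in \<open>simp add: scaleR_conv_of_real [where 'a = complex]\<close>)
  then have "matrix_exp A = (\<chi> i j. \<Sum>k. matrix_power A k $ i $ j / fact k)"
    unfolding matrix_exp_def by (rule sums_unique [symmetric])
  with * show ?thesis by simp
qed

section \<open>Moments and the power series of the expected exponential\<close>

lemma borel_measurable_matrix_power_nth:
  fixes X :: "'a \<Rightarrow> complex ^ 'n ^ 'n"
  assumes "\<And>i j. (\<lambda>\<omega>. X \<omega> $ i $ j) \<in> borel_measurable M"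
  shows "(\<lambda>\<omega>. matrix_power (X \<omega>) k $ i $ j) \<in> borel_measurable M"
proof (induction k arbitrary: i j)
  case (Suc k)
  show ?case
    by (simp add: matrix_matrix_mult_def) (intro borel_measurable_sum borel_measurable_times assms Suc)
qed simp

lemma matrix_moment_nth:
  "matrix_moment M X k $ i $ j = (\<integral>\<omega>. matrix_power (X \<omega>) k $ i $ j \<partial>M)"
  by (simp add: matrix_moment_def matrix_expectation_def)

lemma matrix_expectation_exp_sums:
  fixes X :: "'a \<Rightarrow> complex ^ 'n ^ 'n"
  assumes meas: "\<And>i j. (\<lambda>\<omega>. X \<omega> $ i $ j) \<in> borel_measurable M"
    and bound: "\<And>\<omega> i j. norm (X \<omega> $ i $ j) \<le> Y \<omega>"
    and \<epsilon>: "0 < \<epsilon>" "integrable M (\<lambda>\<omega>. exp (\<epsilon> * (real CARD('n) * Y \<omega>)))"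
    and z: "norm z \<le> \<epsilon>"
  shows "(\<lambda>k. z ^ k / fact k * matrix_moment M X k $ i $ j) sums
    (matrix_expectation M (\<lambda>\<omega>. matrix_exp (matrix_scale z (X \<omega>))) $ i $ j)"
proof -
  define N where "N \<omega> = real CARD('n) * Y \<omega>" for \<omega>
  have N: "0 \<le> N \<omega>" for \<omega>
    unfolding N_def using order_trans[OF norm_ge_zero bound] by simp
  have le: "norm (matrix_power (X \<omega>) k $ i $ j) \<le> N \<omega> ^ k" for \<omega> k i j
    unfolding N_def by (rule norm_matrix_power_nth_le) (rule bound)
  have [measurable]: "(\<lambda>\<omega>. matrix_power (X \<omega>) k $ i $ j) \<in> borel_measurable M" for k i j
    by (rule borel_measurable_matrix_power_nth) (rule meas)
  \<comment> \<open>Term-by-term integration needs finite moments; the bound on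
    \<open>N \<omega> ^ k\<close> is one term of the exponential series at
    \<open>\<epsilon> * N \<omega>\<close>.\<close>
  have int: "integrable M (\<lambda>\<omega>. matrix_power (X \<omega>) k $ i $ j)" for k
  proof (rule Bochner_Integration.integrable_bound)
    show "integrable M (\<lambda>\<omega>. fact k / \<epsilon> ^ k * exp (\<epsilon> * (real CARD('n) * Y \<omega>)))"
      by (rule integrable_mult_right) (rule \<epsilon>)
    have "norm (matrix_power (X \<omega>) k $ i $ j) \<le> fact k / \<epsilon> ^ k * exp (\<epsilon> * N \<omega>)" for \<omega>
    proof -
      have "\<epsilon> ^ k * N \<omega> ^ k \<le> fact k * exp (\<epsilon> * N \<omega>)"
        using power_le_fact_mult_exp[of "\<epsilon> * N \<omega>" k] \<epsilon>(1) N[of \<omega>] by (simp add: power_mult_distrib)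
      then have "N \<omega> ^ k \<le> fact k / \<epsilon> ^ k * exp (\<epsilon> * N \<omega>)"
        using \<epsilon>(1) by (simp add: field_simps)
      with le show ?thesis by (rule order_trans)
    qed
    then show "AE \<omega> in M. norm (matrix_power (X \<omega>) k $ i $ j)
        \<le> norm (fact k / \<epsilon> ^ k * exp (\<epsilon> * (real CARD('n) * Y \<omega>)))"
      using \<epsilon>(1) by (simp add: N_def)
  qed simp
  define s where "s n \<omega> = (\<Sum>k<n. z ^ k / fact k * matrix_power (X \<omega>) k $ i $ j)" for n \<omega>
  have [measurable]: "s n \<in> borel_measurable M" for n
    unfolding s_def by measurable
  have lim: "(\<lambda>n. s n \<omega>) \<longlonglongrightarrow> matrix_exp (matrix_scale z (X \<omega>)) $ i $ j" for \<omega>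
    using matrix_exp_nth_sums[of "matrix_scale z (X \<omega>)" i j]
    by (simp add: s_def sums_def matrix_power_scale)
  have "norm (s n \<omega>) \<le> exp (\<epsilon> * (real CARD('n) * Y \<omega>))" for n \<omega>
  proof -
    have "norm (s n \<omega>) \<le> (\<Sum>k<n. (\<epsilon> * N \<omega>) ^ k / fact k)"
      unfolding s_def
    proof (rule sum_norm_le)
      fix k
      have "norm z ^ k * norm (matrix_power (X \<omega>) k $ i $ j) \<le> \<epsilon> ^ k * N \<omega> ^ k"
        by (intro mult_mono power_mono z le) (use \<epsilon>(1) in auto)
      then show "norm (z ^ k / fact k * matrix_power (X \<omega>) k $ i $ j) \<le> (\<epsilon> * N \<omega>) ^ k / fact k"
        by (simp add: norm_mult norm_divide norm_power power_mult_distrib divide_right_mono)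
    qed
    also have "\<dots> \<le> exp (\<epsilon> * N \<omega>)"
      using \<epsilon>(1) N by (intro sum_power_div_fact_le_exp) simp
    finally show ?thesis by (simp add: N_def)
  qed
  then have "(\<lambda>n. \<integral>\<omega>. s n \<omega> \<partial>M) \<longlonglongrightarrow> (\<integral>\<omega>. matrix_exp (matrix_scale z (X \<omega>)) $ i $ j \<partial>M)"
    by (intro integral_dominated_convergence[OF _ _ \<epsilon>(2)])
       (use lim in \<open>auto intro: borel_measurable_LIMSEQ_metric [where f = s]\<close>)
  moreover have "(\<integral>\<omega>. s n \<omega> \<partial>M) = (\<Sum>k<n. z ^ k / fact k * matrix_moment M X k $ i $ j)" for n
    unfolding s_def using int by (subst Bochner_Integration.integral_sum) (auto simp: matrix_moment_nth)
  ultimately show ?thesis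
    by (simp add: sums_def matrix_expectation_def)
qed

section \<open>Iterated derivatives\<close>

lemma has_vector_derivative_vecI:
  fixes f :: "real \<Rightarrow> 'a::real_normed_vector ^ 'n"
  assumes "\<And>i. ((\<lambda>t. f t $ i) has_vector_derivative f' $ i) F"
  shows "(f has_vector_derivative f') F"
  unfolding has_vector_derivative_def has_derivative_def
proof
  show "bounded_linear (\<lambda>x. x *\<^sub>R f')"
    by (rule bounded_linear_scaleR_left)
  show "((\<lambda>y. (f y - f (Lim F (\<lambda>x. x)) - (y - Lim F (\<lambda>x. x)) *\<^sub>R f') /\<^sub>R norm (y - Lim F (\<lambda>x. x))) \<longlongrightarrow> 0) F"
    by (rule vec_tendstoI) (use assms in \<open>simp add: has_vector_derivative_def has_derivative_def\<close>)
qed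

text \<open>Along the real axis the real derivative of a holomorphic function is its complex
  derivative. A whole interval of \<open>t\<close> is covered because the next derivative at
  \<open>t\<close> depends on values near \<open>t\<close>.\<close>

lemma higher_vector_derivative_matrix_nth:
  fixes F :: "real \<Rightarrow> complex ^ 'n ^ 'm"
  assumes hol: "\<And>i j. G i j holomorphic_on ball 0 \<delta>"
    and F: "\<And>t i j. \<bar>t\<bar> < \<delta> \<Longrightarrow> F t $ i $ j = G i j (of_real t)"
    and t: "\<bar>t\<bar> < \<delta>"
  shows "higher_vector_derivative n F t $ i $ j = (deriv ^^ n) (G i j) (of_real t)"
  using t
proof (induction n arbitrary: t i j)
  case 0
  then show ?case by (simp add: higher_vector_derivative_def F)
next
  case (Suc n)
  define D where "D = (\<chi> i j. (deriv ^^ Suc n) (G i j) (of_real t))"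
  \<comment> \<open>\<open>vector_derivative\<close> has the intended value only where a derivative
    exists, so differentiability is proved first, entry by entry.\<close>
  have "(higher_vector_derivative n F has_vector_derivative D) (at t)"
  proof (intro has_vector_derivative_vecI)
    fix i j
    have "((deriv ^^ n) (G i j) has_field_derivative D $ i $ j) (at (of_real t))"
      using holomorphic_derivI[OF holomorphic_higher_deriv[OF hol[of i j] open_ball], where x = "of_real t"]
        Suc.prems by (simp add: D_def)
    then have "((\<lambda>s. (deriv ^^ n) (G i j) (of_real s)) has_vector_derivative D $ i $ j) (at t)"
      by (rule has_vector_derivative_real_field)
    then show "((\<lambda>s. higher_vector_derivative n F s $ i $ j) has_vector_derivative D $ i $ j) (at t)"
    proof (rule has_vector_derivative_transform_within_open)
      show "open {-\<delta><..<\<delta>}" "t \<in> {-\<delta><..<\<delta>}"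
        using Suc.prems by auto
    qed (use Suc.IH in \<open>auto simp: abs_less_iff\<close>)
  qed
  then have "higher_vector_derivative (Suc n) F t = D"
    by (simp add: higher_vector_derivative_def vector_derivative_at)
  then show ?case by (simp add: D_def)
qed

text \<open>One differentiation gives \<open>deriv g w * exp (g w)\<close>, and Leibniz' rule does
  the rest. At \<open>0\<close> this becomes the scalar moment-cumulant recursion up to powers of
  \<open>\<i>\<close>.\<close>

lemma higher_deriv_exp_compose:
  fixes g :: "complex \<Rightarrow> complex"
  assumes g: "g holomorphic_on S" "open S" "z \<in> S"
  shows "(deriv ^^ Suc n) (\<lambda>w. exp (g w)) z =
    (\<Sum>i\<le>n. of_nat (n choose i) * (deriv ^^ Suc i) g z * (deriv ^^ (n - i)) (\<lambda>w. exp (g w)) z)"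
proof -
  have e: "(\<lambda>w. exp (g w)) holomorphic_on S"
    using g by (intro holomorphic_intros)
  have dg: "deriv g holomorphic_on S"
    using g by (intro holomorphic_deriv)
  have "(deriv ^^ Suc n) (\<lambda>w. exp (g w)) z = (deriv ^^ n) (deriv (\<lambda>w. exp (g w))) z"
    by (simp only: funpow_Suc_right comp_def)
  also have "\<dots> = (deriv ^^ n) (\<lambda>w. deriv g w * exp (g w)) z"
  proof (rule higher_deriv_transform_within_open[OF _ _ g(2,3)])
    fix w assume w: "w \<in> S"
    have "(g has_field_derivative deriv g w) (at w)"
      using holomorphic_derivI[OF g(1,2) w] .
    then show "deriv (\<lambda>w. exp (g w)) w = deriv g w * exp (g w)"
      by (intro DERIV_imp_deriv) (auto intro!: derivative_eq_intros)
  qed (use e dg g in \<open>auto intro!: holomorphic_intros holomorphic_deriv\<close>)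
  also have "\<dots> = (\<Sum>i\<le>n. of_nat (n choose i) * (deriv ^^ i) (deriv g) z * (deriv ^^ (n - i)) (\<lambda>w. exp (g w)) z)"
    using higher_deriv_mult[OF dg e g(2,3)] by (simp add: atMost_atLeast0)
  finally show ?thesis
    by (simp only: funpow_Suc_right comp_def)
qed

section \<open>Powers and logarithms of diagonal matrices\<close>

lemma matrix_power_diagonal_nth:
  fixes A :: "'a::semiring_1 ^ 'n ^ 'n"
  assumes "diagonal_matrix A"
  shows "matrix_power A k $ i $ j = (if i = j then (A $ i $ i) ^ k else 0)"
proof (induction k arbitrary: i j)
  case 0
  show ?case by (simp add: mat_def)
next
  case (Suc k)
  have "matrix_power A (Suc k) $ i $ j = (\<Sum>l\<in>UNIV. A $ i $ l * (if l = j then (A $ l $ l) ^ k else 0))"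
    by (simp add: matrix_matrix_mult_def Suc)
  also have "\<dots> = A $ i $ j * (A $ j $ j) ^ k"
    by (simp add: if_distrib cong: if_cong)
  finally show ?case
    using assms by (auto simp: diagonal_matrix_def)
qed

text \<open>Powers of \<open>A - mat 1\<close> stay diagonal, so each diagonal entry is a scalar
  logarithm series, convergent within distance 1 of 1.\<close>

lemma matrix_log_diagonal_nth:
  fixes A :: "complex ^ 'n ^ 'n"
  assumes A: "diagonal_matrix A" "\<And>i. norm (A $ i $ i - 1) < 1"
  shows "matrix_log A $ i $ j = (if i = j then Ln (A $ i $ i) else 0)"
proof -
  have "diagonal_matrix (A - mat 1)"
    using A(1) by (simp add: diagonal_matrix_def mat_def)
  note * = matrix_power_diagonal_nth[OF this]
  \<comment> \<open>The scalar series starts at exponent 0; its term there is a division by zero,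
    hence 0, so the shift to \<open>Suc k\<close> leaves the sum unchanged.\<close>
  have Ln: "(\<lambda>k. (-1) ^ k / of_nat (Suc k) * (A $ i $ i - 1) ^ Suc k) sums Ln (A $ i $ i)" for i
    using Ln_series[OF A(2)[of i]]
      sums_Suc_iff[of "\<lambda>k. (-1) ^ Suc k / of_nat k * (A $ i $ i - 1) ^ k" "Ln (A $ i $ i)"]
    by simp
  have "(\<lambda>k. ((-1) ^ k / real (Suc k)) *\<^sub>R matrix_power (A - mat 1) (Suc k))
      sums (\<chi> i j. if i = j then Ln (A $ i $ i) else 0)"
  proof (intro sums_vecI)
    fix i j
    show "(\<lambda>k. (((-1) ^ k / real (Suc k)) *\<^sub>R matrix_power (A - mat 1) (Suc k)) $ i $ j)
        sums ((\<chi> i j. if i = j then Ln (A $ i $ i) else 0) $ i $ j)"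
      using Ln[of i]
      by (simp add: * scaleR_conv_of_real [where 'a = complex] del: matrix_power.simps of_nat_Suc)
         (auto simp: mat_def)
  qed
  then show ?thesis
    unfolding matrix_log_def by (simp add: sums_unique [symmetric])
qed

section \<open>The moment-cumulant recursion for diagonal moments\<close>

text \<open>Separates the analysis from the Wishart model, which will enter through the exponential
  moment and \<open>diag\<close>. Diagonality splits the matrix identity into one scalar recursion
  per diagonal entry.\<close>

theorem matrix_moment_cumulant_recursion:
  fixes X :: "'a \<Rightarrow> complex ^ 'n ^ 'n"
  assumes "prob_space M"
    and meas: "\<And>i j. (\<lambda>\<omega>. X \<omega> $ i $ j) \<in> borel_measurable M"
    and bound: "\<And>\<omega> i j. norm (X \<omega> $ i $ j) \<le> Y \<omega>"
    and \<epsilon>: "0 < \<epsilon>" "integrable M (\<lambda>\<omega>. exp (\<epsilon> * (real CARD('n) * Y \<omega>)))"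
    and diag: "\<And>k. diagonal_matrix (matrix_moment M X k)"
    and n: "n \<ge> 1"
  shows "matrix_moment M X n =
      matrix_cumulant M X n +
      (\<Sum>l=1..n-1. real ((n - 1) choose (l - 1)) *\<^sub>R
         (matrix_cumulant M X l ** matrix_moment M X (n - l)))"
proof -
  interpret prob_space M by fact
  define m where "m k i = matrix_moment M X k $ i $ i" for k i
  \<comment> \<open>\<open>f i\<close> continues the \<open>i\<close>-th diagonal entry of the
    characteristic function from real to complex arguments.\<close>
  define f where
    "f i z = matrix_expectation M (\<lambda>\<omega>. matrix_exp (matrix_scale (\<i> * z) (X \<omega>))) $ i $ i" for i z
  note sums = matrix_expectation_exp_sums[OF meas bound \<epsilon>]
  have f_sums: "(\<lambda>k. \<i> ^ k * m k i / fact k * z ^ k) sums f i z" if "norm z \<le> \<epsilon>" for i z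
    using sums[of "\<i> * z" i i] that
    by (simp add: f_def m_def norm_mult power_mult_distrib mult_ac)
  have f_hol: "f i holomorphic_on ball 0 \<epsilon>" for i
  proof (rule power_series_holomorphic)
    fix z :: complex assume "z \<in> ball 0 \<epsilon>"
    then show "(\<lambda>k. \<i> ^ k * m k i / fact k * (z - 0) ^ k) sums f i z"
      using f_sums[of z i] by simp
  qed
  \<comment> \<open>By uniqueness of the power series at \<open>0\<close>, the \<open>k\<close>-th
    derivative is \<open>fact k\<close> times the \<open>k\<close>-th coefficient.\<close>
  have deriv_f: "(deriv ^^ k) (f i) 0 = \<i> ^ k * m k i" for i k
  proof -
    have "\<forall>\<^sub>F z in nhds 0. z \<in> ball (0::complex) \<epsilon>"
      using \<epsilon>(1) by (intro eventually_nhds_in_open) auto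
    then have "f i has_fps_expansion Abs_fps (\<lambda>k. \<i> ^ k * m k i / fact k)"
    proof (intro has_fps_expansionI, eventually_elim)
      case (elim z)
      then show ?case using f_sums[of z i] by simp
    qed
    from fps_nth_fps_expansion[OF this, of k] show ?thesis
      by (simp add: field_simps)
  qed
  have m0: "m 0 i = 1" for i
    by (simp add: m_def matrix_moment_def matrix_expectation_def mat_def prob_space)
  then have f0: "f i 0 = 1" for i
    using deriv_f[of 0 i] by simp
  \<comment> \<open>There are finitely many indices, so one radius serves all entries. Distance
    below 1 from 1 is used twice: for convergence of the logarithm series and to stay off the branch
    cut of \<open>Ln\<close>.\<close>
  have "\<forall>\<^sub>F z in nhds 0. \<forall>i. dist (f i z) 1 < 1"
  proof (rule eventually_all_finite)
    fix i
    have "isCont (f i) 0"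
      using holomorphic_on_imp_continuous_on[OF f_hol] \<epsilon>(1)
      by (metis centre_in_ball continuous_on_eq_continuous_at open_ball)
    then have "(f i \<longlongrightarrow> 1) (nhds 0)"
      using f0 by (simp add: isCont_def tendsto_nhds_iff)
    then show "\<forall>\<^sub>F z in nhds 0. dist (f i z) 1 < 1"
      by (rule tendstoD) simp
  qed
  then obtain \<eta> where \<eta>: "0 < \<eta>" "\<And>z i. norm z < \<eta> \<Longrightarrow> norm (f i z - 1) < 1"
    by (auto simp: eventually_nhds_metric dist_norm)
  define \<delta> where "\<delta> = min \<eta> \<epsilon>"
  have \<delta>: "0 < \<delta>" "\<delta> \<le> \<epsilon>" "\<And>z i. norm z < \<delta> \<Longrightarrow> norm (f i z - 1) < 1"
    using \<eta> \<epsilon>(1) by (auto simp: \<delta>_def)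
  \<comment> \<open>Distance below 1 from 1 forces a positive real part.\<close>
  have f_slit: "f i z \<notin> \<real>\<^sub>\<le>\<^sub>0" if "norm z < \<delta>" for i z
  proof
    assume "f i z \<in> \<real>\<^sub>\<le>\<^sub>0"
    moreover have "\<bar>Re (f i z - 1)\<bar> < 1"
      using \<delta>(3)[OF that, of i] abs_Re_le_cmod[of "f i z - 1"] by linarith
    ultimately show False by (auto simp: complex_nonpos_Reals_iff)
  qed
  define g where "g i z = Ln (f i z)" for i z
  have g_hol: "g i holomorphic_on ball 0 \<delta>" for i
    unfolding g_def using f_slit \<delta>(2)
    by (intro holomorphic_intros holomorphic_on_subset[OF f_hol]) auto
  define G where "G i j = (if i = j then g i else (\<lambda>_. 0))" for i j
  have log_char: "matrix_log_char M X t $ i $ j = G i j (of_real t)" if t: "\<bar>t\<bar> < \<delta>" for t i j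
  proof -
    \<comment> \<open>By \<open>diag\<close>, every coefficient in the moment series of this entry
      vanishes.\<close>
    have offdiag: "matrix_char M X t $ i $ j = 0" if "i \<noteq> j" for i j
    proof -
      have "(\<lambda>k. 0) sums (matrix_char M X t $ i $ j)"
        using sums[of "\<i> * of_real t" i j] t \<delta>(2) diag that
        by (simp add: matrix_char_def diagonal_matrix_def norm_mult)
      then show ?thesis
        using sums_unique2 sums_zero by blast
    qed
    have ii: "matrix_char M X t $ i $ i = f i (of_real t)" for i
      by (simp add: matrix_char_def f_def)
    show ?thesis
      unfolding matrix_log_char_def
      by (subst matrix_log_diagonal_nth)
         (use offdiag t \<delta>(3) in \<open>auto simp: diagonal_matrix_def ii G_def g_def\<close>)
  qed
  have "higher_vector_derivative k (matrix_log_char M X) 0 $ i $ j = (deriv ^^ k) (G i j) 0" for k i j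
    using higher_vector_derivative_matrix_nth[of G \<delta> "matrix_log_char M X" 0 k i j] g_hol log_char \<delta>(1)
    by (auto simp: G_def)
  moreover have "(deriv ^^ k) (\<lambda>_. 0) 0 = (0::complex)" for k
    by (simp add: higher_deriv_const)
  ultimately have K: "matrix_cumulant M X k $ i $ j = (if i = j then inverse (\<i> ^ k) * (deriv ^^ k) (g i) 0 else 0)" for k i j
    by (simp add: matrix_cumulant_def G_def)
  define \<kappa> where "\<kappa> k i = matrix_cumulant M X k $ i $ i" for k i
  have deriv_g: "(deriv ^^ k) (g i) 0 = \<i> ^ k * \<kappa> k i" for k i
    by (simp add: \<kappa>_def K)
  obtain N where N: "n = Suc N"
    using n by (cases n) auto
  have rec: "m (Suc N) i = (\<Sum>k\<le>N. of_nat (N choose k) * \<kappa> (Suc k) i * m (N - k) i)" for i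
  proof -
    \<comment> \<open>Since \<open>f i\<close> has no zero on the disc, exponentiating its
      \<open>Ln\<close> gives it back there, and functions that agree near \<open>0\<close> share
      their derivatives.\<close>
    have exp_g: "(deriv ^^ k) (\<lambda>w. exp (g i w)) 0 = (deriv ^^ k) (f i) 0" for k
    proof (rule higher_deriv_transform_within_open[where S = "ball 0 \<delta>"])
      show "(\<lambda>w. exp (g i w)) holomorphic_on ball 0 \<delta>"
        using g_hol by (intro holomorphic_intros)
      show "f i holomorphic_on ball 0 \<delta>"
        using \<delta>(2) by (intro holomorphic_on_subset[OF f_hol]) auto
      show "exp (g i w) = f i w" if "w \<in> ball 0 \<delta>" for w
      proof -
        have "f i w \<noteq> 0" using f_slit[of w i] that by auto
        then show ?thesis by (simp add: g_def)
      qed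
    qed (use \<delta>(1) in auto)
    have "\<i> ^ Suc N * m (Suc N) i =
        (\<Sum>k\<le>N. of_nat (N choose k) * (deriv ^^ Suc k) (g i) 0 * (deriv ^^ (N - k)) (f i) 0)"
      using higher_deriv_exp_compose[OF g_hol[of i] open_ball, where z = 0 and n = N] \<delta>(1)
      by (simp only: exp_g deriv_f centre_in_ball)
    \<comment> \<open>Each summand carries \<open>\<i>\<close> to the total order
      \<open>Suc k + (N - k)\<close>, which is \<open>Suc N\<close>: a nonzero factor common to both
      sides.\<close>
    also have "\<dots> = (\<Sum>k\<le>N. \<i> ^ Suc N * (of_nat (N choose k) * \<kappa> (Suc k) i * m (N - k) i))"
    proof (rule sum.cong)
      fix k assume "k \<in> {..N}"
      then have "\<i> ^ Suc N = \<i> ^ Suc k * \<i> ^ (N - k)"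
        by (simp flip: power_add)
      then show "of_nat (N choose k) * (deriv ^^ Suc k) (g i) 0 * (deriv ^^ (N - k)) (f i) 0
          = \<i> ^ Suc N * (of_nat (N choose k) * \<kappa> (Suc k) i * m (N - k) i)"
        by (simp only: deriv_g deriv_f mult_ac)
    qed simp
    finally show ?thesis
      by (simp flip: sum_distrib_left)
  qed
  have prod: "(matrix_cumulant M X l ** matrix_moment M X k) $ i $ j = (if i = j then \<kappa> l i * m k i else 0)"
    for l k i j
  proof -
    have "(matrix_cumulant M X l ** matrix_moment M X k) $ i $ j = \<kappa> l i * matrix_moment M X k $ i $ j"
      by (simp add: matrix_matrix_mult_def K \<kappa>_def if_distrib if_distribR cong: if_cong)
    then show ?thesis
      using diag by (auto simp: diagonal_matrix_def m_def)
  qed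
  \<comment> \<open>The shift \<open>l = Suc k\<close> leaves out \<open>k = N\<close>. That term is
    \<open>\<kappa> (Suc N) i * m 0 i\<close>, and \<open>m 0 i = 1\<close> makes it the leading
    cumulant.\<close>
  have "(\<Sum>l=1..N. real (N choose (l - 1)) *\<^sub>R (\<kappa> l i * m (Suc N - l) i)) =
      (\<Sum>k<N. of_nat (N choose k) * \<kappa> (Suc k) i * m (N - k) i)" for i
    by (rule sum.reindex_bij_witness[where i = Suc and j = "\<lambda>l. l - 1"])
       (auto simp: scaleR_conv_of_real Suc_diff_le)
  then have ii: "m (Suc N) i = \<kappa> (Suc N) i
      + (\<Sum>l=1..N. real (N choose (l - 1)) *\<^sub>R (\<kappa> l i * m (Suc N - l) i))" for i
    using rec[of i] by (simp add: lessThan_Suc_atMost [symmetric] m0)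
  show ?thesis
  proof (intro iffD2[OF vec_eq_iff] allI)
    fix i j
    show "matrix_moment M X n $ i $ j = (matrix_cumulant M X n +
      (\<Sum>l=1..n-1. real ((n - 1) choose (l - 1)) *\<^sub>R
         (matrix_cumulant M X l ** matrix_moment M X (n - l)))) $ i $ j"
    proof (cases "i = j")
      case True
      then show ?thesis
        using ii[of j] by (simp add: N prod m_def \<kappa>_def)
    next
      case False
      then show ?thesis
        using diag by (simp add: prod K diagonal_matrix_def)
    qed
  qed
qed

section \<open>Exponential moments of Gaussian vectors\<close>

text \<open>A sum is at most \<open>card I\<close> times its largest term, whose exponential occurs
  on the right. Exponential moments of a sum thus reduce to those of its summands.\<close>

lemma exp_sum_le:
  fixes f :: "'i \<Rightarrow> real"
  assumes "finite I" "I \<noteq> {}"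
  shows "exp (sum f I) \<le> (\<Sum>i\<in>I. exp (real (card I) * f i))"
proof -
  have "Max (f ` I) \<in> f ` I"
    using assms by (intro Max_in) auto
  then obtain k where "k \<in> I" "f k = Max (f ` I)"
    by auto
  with assms(1) have k: "k \<in> I" "\<And>i. i \<in> I \<Longrightarrow> f i \<le> f k"
    by auto
  have "exp (sum f I) \<le> exp (real (card I) * f k)"
    using sum_bounded_above[of I f "f k"] k(2) by simp
  also have "\<dots> \<le> (\<Sum>i\<in>I. exp (real (card I) * f i))"
    using member_le_sum[OF k(1), of "\<lambda>i. exp (real (card I) * f i)"] assms(1) by simp
  finally show ?thesis .
qed

text \<open>Multiplying the density by \<open>exp (c * x\<^sup>2)\<close> gives a multiple of
  another centred normal density; the condition on \<open>c\<close> keeps its variance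
  positive.\<close>

lemma integrable_exp_square_normal:
  assumes Z: "distributed M lborel Z (\<lambda>x. ennreal (normal_density 0 \<sigma> x))"
    and \<sigma>: "0 < \<sigma>" "2 * c * \<sigma>\<^sup>2 < 1"
  shows "integrable M (\<lambda>\<omega>. exp (c * (Z \<omega>)\<^sup>2))"
proof -
  \<comment> \<open>Adding the exponents requires
    \<open>1 / \<tau>\<^sup>2 = 1 / \<sigma>\<^sup>2 - 2 * c\<close>.\<close>
  define \<tau> where "\<tau> = \<sigma> / sqrt (1 - 2 * c * \<sigma>\<^sup>2)"
  have \<tau>: "\<tau>\<^sup>2 = \<sigma>\<^sup>2 / (1 - 2 * c * \<sigma>\<^sup>2)" "0 < \<tau>"
    using \<sigma> by (auto simp: \<tau>_def power_divide)
  have "exp (- x\<^sup>2 / (2 * \<sigma>\<^sup>2)) * exp (c * x\<^sup>2) = exp (- x\<^sup>2 / (2 * \<tau>\<^sup>2))" for x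
  proof -
    have "- x\<^sup>2 / (2 * \<sigma>\<^sup>2) + c * x\<^sup>2 = - x\<^sup>2 / (2 * \<tau>\<^sup>2)"
      unfolding \<tau>(1) using \<sigma> by (simp add: field_simps)
    then show ?thesis by (simp flip: exp_add)
  qed
  then have "normal_density 0 \<sigma> x * exp (c * x\<^sup>2)
      = sqrt (2 * pi * \<tau>\<^sup>2) / sqrt (2 * pi * \<sigma>\<^sup>2) * normal_density 0 \<tau> x" for x
    using \<sigma> \<tau>(2) by (simp add: normal_density_def real_sqrt_mult)
  moreover have "integrable lborel (\<lambda>x. sqrt (2 * pi * \<tau>\<^sup>2) / sqrt (2 * pi * \<sigma>\<^sup>2) * normal_density 0 \<tau> x)"
    using \<tau>(2) by (intro integrable_mult_right integrable_normal_density)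
  ultimately have "integrable lborel (\<lambda>x. normal_density 0 \<sigma> x * exp (c * x\<^sup>2))"
    by simp
  then show ?thesis
    by (subst (asm) distributed_integrable[OF Z]) auto
qed

lemma norm_vec_square: "(norm (x :: complex ^ 'n))\<^sup>2 = (\<Sum>i\<in>UNIV. (Re (x $ i))\<^sup>2 + (Im (x $ i))\<^sup>2)"
  by (simp add: norm_vec_def L2_set_def sum_nonneg cmod_power2)

lemma integrable_exp_sum_norm_square:
  fixes h :: "'i \<Rightarrow> 'a \<Rightarrow> complex ^ 'n"
  assumes M: "prob_space M" and I: "finite I" "I \<noteq> {}"
    and h: "\<And>r. r \<in> I \<Longrightarrow> iid_standard_complex_gaussian M (h r)"
  obtains c where "0 < c" "integrable M (\<lambda>\<omega>. exp (c * (\<Sum>r\<in>I. (norm (h r \<omega>))\<^sup>2)))"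
proof -
  \<comment> \<open>\<open>J\<close> indexes the real coordinates of all the vectors; the flag
    selects real or imaginary part.\<close>
  define J where "J = I \<times> (UNIV :: 'n set) \<times> (UNIV :: bool set)"
  define y where "y = (\<lambda>(r, i, b) \<omega>. if b then Re (h r \<omega> $ i) else Im (h r \<omega> $ i))"
  \<comment> \<open>\<open>exp_sum_le\<close> multiplies each coefficient by \<open>card J\<close>,
    so this \<open>c\<close> leaves \<open>1/2\<close>, which is admissible for variance
    \<open>1/2\<close> because \<open>2 * (1/2) * (1/2) < 1\<close>.\<close>
  define c where "c = 1 / (2 * real (card J))"
  have J: "finite J" "J \<noteq> {}" using I by (auto simp: J_def)
  then have cJ: "0 < card J" by (simp add: card_gt_0_iff)
  have y: "distributed M lborel (y p) (\<lambda>x. ennreal (normal_density 0 (sqrt (1/2)) x))" if "p \<in> J" for p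
    using that h
    by (cases p; cases "snd (snd p)")
       (auto simp: J_def y_def iid_standard_complex_gaussian_def standard_complex_gaussian_def)
  have y_int: "integrable M (\<lambda>\<omega>. exp (1/2 * (y p \<omega>)\<^sup>2))" if "p \<in> J" for p
    by (rule integrable_exp_square_normal[OF y[OF that]]) auto
  have [measurable]: "y p \<in> borel_measurable M" if "p \<in> J" for p
    using distributed_measurable[OF y[OF that]] by simp
  have S: "(\<Sum>r\<in>I. (norm (h r \<omega>))\<^sup>2) = (\<Sum>p\<in>J. (y p \<omega>)\<^sup>2)" for \<omega>
    by (simp add: J_def sum.cartesian_product' y_def norm_vec_square UNIV_bool add.commute)
  have "integrable M (\<lambda>\<omega>. exp (c * (\<Sum>r\<in>I. (norm (h r \<omega>))\<^sup>2)))"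
  proof (rule Bochner_Integration.integrable_bound)
    show "integrable M (\<lambda>\<omega>. \<Sum>p\<in>J. exp (1/2 * (y p \<omega>)\<^sup>2))"
      using y_int by auto
    show "(\<lambda>\<omega>. exp (c * (\<Sum>r\<in>I. (norm (h r \<omega>))\<^sup>2))) \<in> borel_measurable M"
      unfolding S by measurable
    have "exp (c * (\<Sum>r\<in>I. (norm (h r \<omega>))\<^sup>2)) \<le> (\<Sum>p\<in>J. exp (1/2 * (y p \<omega>)\<^sup>2))" for \<omega>
      using exp_sum_le[OF J, of "\<lambda>p. c * (y p \<omega>)\<^sup>2"] cJ by (simp add: S c_def sum_distrib_left)
    then show "AE \<omega> in M. norm (exp (c * (\<Sum>r\<in>I. (norm (h r \<omega>))\<^sup>2))) \<le> norm (\<Sum>p\<in>J. exp (1/2 * (y p \<omega>)\<^sup>2))"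
      by (simp add: sum_nonneg)
  qed
  with cJ show ?thesis
    by (intro that[of c]) (auto simp: c_def)
qed

section \<open>Entries of Wishart matrices with one degree of freedom\<close>

text \<open>A diagonal factor scales rows on the left and columns on the right. This formula
  replaces the matrix product from here on.\<close>

lemma wishart1_nth:
  fixes S :: "real ^ 't ^ 't"
  assumes "diagonal_covariance S"
  shows "wishart1 S v $ i $ j = of_real (sqrt (S $ i $ i) * sqrt (S $ j $ j)) * (v $ i * cnj (v $ j))"
proof -
  have S: "S $ i $ j = 0" if "i \<noteq> j" for i j
    using assms that by (simp add: diagonal_covariance_def diagonal_matrix_def)
  define Q where "Q = map_matrix complex_of_real (matrix_sqrt_diagonal S)"
  define V where "V = (columnvector v :: complex ^ 1 ^ 't) ** hermitian_transpose (columnvector v)"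
  have Q: "Q $ i $ j = (if i = j then of_real (sqrt (S $ i $ i)) else 0)" for i j
    using S by (simp add: Q_def map_matrix_def matrix_sqrt_diagonal_def)
  have V: "V $ i $ j = v $ i * cnj (v $ j)" for i j
    by (simp add: V_def matrix_matrix_mult_def map_matrix_def hermitian_transpose_def
        transpose_def columnvector_def)
  have "wishart1 S v = Q ** V ** Q"
    by (simp add: wishart1_def Let_def Q_def V_def)
  then show ?thesis
    by (simp add: matrix_matrix_mult_def Q V if_distrib if_distribR cong: if_cong)
qed

lemma norm_wishart1_nth_le:
  assumes "diagonal_covariance S"
  shows "norm (wishart1 S v $ i $ j) \<le> (\<Sum>i\<in>UNIV. sqrt (S $ i $ i))\<^sup>2 * (norm v)\<^sup>2"
proof -
  have S: "0 \<le> S $ i $ i" for i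
    using assms by (simp add: diagonal_covariance_def)
  then have le: "sqrt (S $ i $ i) \<le> (\<Sum>i\<in>UNIV. sqrt (S $ i $ i))" for i
    by (intro member_le_sum) auto
  have "norm (wishart1 S v $ i $ j)
      = (sqrt (S $ i $ i) * sqrt (S $ j $ j)) * (norm (v $ i) * norm (v $ j))"
    using S by (simp add: wishart1_nth[OF assms] norm_mult)
  also have "\<dots> \<le> ((\<Sum>i\<in>UNIV. sqrt (S $ i $ i)) * (\<Sum>i\<in>UNIV. sqrt (S $ i $ i))) * (norm v * norm v)"
    using S by (intro mult_mono le Finite_Cartesian_Product.norm_nth_le mult_nonneg_nonneg sum_nonneg) auto
  finally show ?thesis by (simp add: power2_eq_square)
qed


lemma borel_measurable_vec_nth: "(\<lambda>v::complex ^ 'n. v $ i) \<in> borel_measurable borel"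
  by (intro borel_measurable_continuous_onI linear_continuous_on bounded_linear_vec_nth)

lemma borel_measurable_wishart1_nth:
  assumes S: "diagonal_covariance S" and v: "v \<in> borel_measurable M"
  shows "(\<lambda>\<omega>. wishart1 S (v \<omega>) $ i $ j) \<in> borel_measurable M"
proof -
  have nth: "(\<lambda>\<omega>. v \<omega> $ i) \<in> borel_measurable M" for i
    using v borel_measurable_vec_nth by (rule measurable_compose)
  have "(\<lambda>\<omega>. cnj (v \<omega> $ i)) \<in> borel_measurable M" for i
    by (rule measurable_compose[OF nth]) (intro borel_measurable_continuous_onI continuous_intros)
  with nth show ?thesis
    unfolding wishart1_nth[OF S] by (intro borel_measurable_times borel_measurable_const)
qed

section \<open>Sign symmetry of Gaussian vectors\<close>

text \<open>Multiplication by a diagonal sign matrix with a single -1, which commutes with every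
  diagonal covariance.\<close>

definition negate_component :: "'n \<Rightarrow> complex ^ 'n \<Rightarrow> complex ^ 'n" where
  "negate_component l v = (\<chi> i. (if i = l then -1 else 1) * v $ i)"

text \<open>Joint laws of coordinates live on the product sigma-algebra, laws of vectors on the
  Borel one; this map leads from the first to the second.\<close>

lemma borel_measurable_vec_lambda:
  "(\<lambda>f. \<chi> i. (f i :: complex)) \<in> borel_measurable (Pi\<^sub>M (UNIV :: 'n::finite set) (\<lambda>_. borel))"
proof (rule iffD2[OF borel_measurable_euclidean_space], rule ballI)
  fix b :: "complex ^ 'n"
  assume "b \<in> Basis"
  then obtain i u where "b = axis i u"
    by (auto simp: Basis_vec_def)
  then show "(\<lambda>f. (\<chi> i. (f i :: complex)) \<bullet> b) \<in> borel_measurable (Pi\<^sub>M UNIV (\<lambda>_. borel))"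
    by (simp add: inner_axis)
qed

lemma borel_measurable_negate_component: "negate_component l \<in> borel_measurable borel"
  unfolding negate_component_def
  by (intro borel_measurable_continuous_onI continuous_intros)

text \<open>Under independence the joint law is the product of the marginals. It serves first the
  coordinates of one vector, then the family of vectors.\<close>

lemma (in prob_space) indep_vars_distr_eq:
  assumes "I \<noteq> {}" "indep_vars N X I" "indep_vars N Y I"
    and "\<And>i. i \<in> I \<Longrightarrow> distr M (N i) (X i) = distr M (N i) (Y i)"
  shows "distr M (Pi\<^sub>M I N) (\<lambda>\<omega>. \<lambda>i\<in>I. X i \<omega>) = distr M (Pi\<^sub>M I N) (\<lambda>\<omega>. \<lambda>i\<in>I. Y i \<omega>)"
proof -
  have X: "random_variable (N i) (X i)" and Y: "random_variable (N i) (Y i)" if "i \<in> I" for i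
    using assms(2,3) that by (auto simp: indep_vars_def)
  have "distr M (Pi\<^sub>M I N) (\<lambda>\<omega>. \<lambda>i\<in>I. X i \<omega>) = (\<Pi>\<^sub>M i\<in>I. distr M (N i) (X i))"
    using indep_vars_iff_distr_eq_PiM'[OF assms(1) X] assms(2) by simp
  also have "\<dots> = (\<Pi>\<^sub>M i\<in>I. distr M (N i) (Y i))"
    using assms(4) by (intro PiM_cong) auto
  also have "\<dots> = distr M (Pi\<^sub>M I N) (\<lambda>\<omega>. \<lambda>i\<in>I. Y i \<omega>)"
    using indep_vars_iff_distr_eq_PiM'[OF assms(1) Y] assms(3) by simp
  finally show ?thesis .
qed

lemma (in prob_space) distr_uminus_normal:
  assumes "distributed M lborel Z (\<lambda>x. ennreal (normal_density 0 \<sigma> x))" "0 < \<sigma>"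
  shows "distr M borel (\<lambda>\<omega>. - Z \<omega>) = distr M borel Z"
proof -
  have "distributed M lborel (\<lambda>\<omega>. - Z \<omega>) (\<lambda>x. ennreal (normal_density 0 \<sigma> x))"
    using normal_density_affine[OF assms(1,2), of "-1" 0] by simp
  then have "distr M lborel (\<lambda>\<omega>. - Z \<omega>) = distr M lborel Z"
    using assms(1) by (simp add: distributed_distr_eq_density)
  \<comment> \<open>\<open>lborel\<close> and \<open>borel\<close> have the same sets, and only the
    sets of the target matter to \<open>distr\<close>.\<close>
  moreover have "distr M borel f = distr M lborel f" for f :: "'a \<Rightarrow> real"
    by (rule distr_cong) auto
  ultimately show ?thesis by simp
qed

text \<open>Negation preserves both centred normal parts and their independence, hence the law of
  the pair.\<close>

lemma (in prob_space) distr_uminus_complex_gaussian: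
  assumes Z: "standard_complex_gaussian M Z"
  shows "distr M borel (\<lambda>\<omega>. - Z \<omega>) = distr M borel Z"
proof -
  \<comment> \<open>\<open>c\<close> reassembles a complex number from its parts, so the law of
    \<open>Z\<close> is an image of the law of the pair.\<close>
  define c where "c p = complex_of_real (fst p) + \<i> * complex_of_real (snd p)" for p
  have [measurable]: "c \<in> borel_measurable (borel \<Otimes>\<^sub>M borel)"
    unfolding c_def borel_prod by (intro borel_measurable_continuous_onI continuous_intros)
  have c: "c (Re z, Im z) = z" "c (- Re z, - Im z) = - z" for z
    by (auto simp: c_def complex_eq_iff)
  have ind: "indep_var borel (\<lambda>\<omega>. Re (Z \<omega>)) borel (\<lambda>\<omega>. Im (Z \<omega>))"
    and N: "distributed M lborel (\<lambda>\<omega>. Re (Z \<omega>)) (\<lambda>x. ennreal (normal_density 0 (sqrt (1/2)) x))"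
      "distributed M lborel (\<lambda>\<omega>. Im (Z \<omega>)) (\<lambda>x. ennreal (normal_density 0 (sqrt (1/2)) x))"
    using Z by (auto simp: standard_complex_gaussian_def)
  have ind': "indep_var borel (\<lambda>\<omega>. - Re (Z \<omega>)) borel (\<lambda>\<omega>. - Im (Z \<omega>))"
    using indep_var_compose[OF ind, of uminus borel uminus borel] by (simp add: comp_def)
  have [measurable]: "(\<lambda>\<omega>. Re (Z \<omega>)) \<in> borel_measurable M" "(\<lambda>\<omega>. Im (Z \<omega>)) \<in> borel_measurable M"
    using ind by (auto simp: indep_var_distribution_eq)
  have "distr M (borel \<Otimes>\<^sub>M borel) (\<lambda>\<omega>. (- Re (Z \<omega>), - Im (Z \<omega>)))
      = distr M (borel \<Otimes>\<^sub>M borel) (\<lambda>\<omega>. (Re (Z \<omega>), Im (Z \<omega>)))"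
    using ind ind' by (simp add: indep_var_distribution_eq distr_uminus_normal[OF N(1)] distr_uminus_normal[OF N(2)])
  moreover have compose: "distr M borel (\<lambda>\<omega>. c (U \<omega>, V \<omega>))
      = distr (distr M (borel \<Otimes>\<^sub>M borel) (\<lambda>\<omega>. (U \<omega>, V \<omega>))) borel c"
    if [measurable]: "U \<in> borel_measurable M" "V \<in> borel_measurable M" for U V
    by (subst distr_distr) (auto simp: comp_def)
  ultimately have "distr M borel (\<lambda>\<omega>. c (- Re (Z \<omega>), - Im (Z \<omega>))) = distr M borel (\<lambda>\<omega>. c (Re (Z \<omega>), Im (Z \<omega>)))"
    by (subst (1 2) compose) auto
  then show ?thesis
    unfolding c .
qed

lemma (in prob_space) iid_standard_complex_gaussian_borel_measurable:
  assumes "iid_standard_complex_gaussian M v"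
  shows "v \<in> borel_measurable M"
proof -
  have [measurable]: "(\<lambda>\<omega>. v \<omega> $ i) \<in> borel_measurable M" for i
    using assms by (auto simp: iid_standard_complex_gaussian_def indep_vars_def)
  show ?thesis
    by (rule iffD2[OF borel_measurable_euclidean_space]) (auto simp: Basis_vec_def inner_axis)
qed

text \<open>The signed coordinates are again independent with unchanged marginals; assembling them
  into a vector carries this over to the law of \<open>v\<close>.\<close>

lemma (in prob_space) distr_negate_component:
  fixes v :: "'a \<Rightarrow> complex ^ 'n"
  assumes v: "iid_standard_complex_gaussian M v"
  shows "distr M borel (\<lambda>\<omega>. negate_component l (v \<omega>)) = distr M borel v"
proof -
  define X where "X i \<omega> = v \<omega> $ i" for i \<omega>
  define Y where "Y i \<omega> = (if i = l then -1 else 1) * v \<omega> $ i" for i \<omega>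
  have X: "indep_vars (\<lambda>_. borel) X UNIV"
    using v by (simp add: X_def [abs_def] iid_standard_complex_gaussian_def)
  then have Y: "indep_vars (\<lambda>_. borel) Y UNIV"
    unfolding X_def [abs_def] Y_def [abs_def] by (rule indep_vars_compose2) simp
  have [measurable]: "X i \<in> borel_measurable M" "Y i \<in> borel_measurable M" for i
    using X Y by (auto simp: indep_vars_def)
  have "distr M borel (X i) = distr M borel (Y i)" for i
    using v distr_uminus_complex_gaussian[of "X l"]
    by (auto simp: X_def [abs_def] Y_def [abs_def] iid_standard_complex_gaussian_def)
  then have distr: "distr M (Pi\<^sub>M UNIV (\<lambda>_. borel)) (\<lambda>\<omega> i. X i \<omega>)
      = distr M (Pi\<^sub>M UNIV (\<lambda>_. borel)) (\<lambda>\<omega> i. Y i \<omega>)"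
    using indep_vars_distr_eq[OF _ X Y] by (simp add: restrict_UNIV)
  have compose: "distr M borel (\<lambda>\<omega>. \<chi> i. Z i \<omega>)
      = distr (distr M (Pi\<^sub>M UNIV (\<lambda>_. borel)) (\<lambda>\<omega> i. Z i \<omega>)) borel (\<lambda>f. \<chi> i. f i)"
    if "\<And>i. Z i \<in> borel_measurable M" for Z :: "'n \<Rightarrow> 'a \<Rightarrow> complex"
  proof (subst distr_distr[OF borel_measurable_vec_lambda])
    show "(\<lambda>\<omega> i. Z i \<omega>) \<in> measurable M (Pi\<^sub>M UNIV (\<lambda>_. borel))"
      using measurable_restrict[of UNIV Z M "\<lambda>_. borel"] that by (simp add: restrict_UNIV)
  qed (simp add: comp_def)
  have "v = (\<lambda>\<omega>. \<chi> i. X i \<omega>)" "(\<lambda>\<omega>. negate_component l (v \<omega>)) = (\<lambda>\<omega>. \<chi> i. Y i \<omega>)"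
    by (auto simp: X_def Y_def negate_component_def)
  then show ?thesis
    using compose[of X] compose[of Y] distr by simp
qed

section \<open>Vanishing of the off-diagonal moments\<close>

lemma wishart1_negate_component:
  assumes "diagonal_covariance S"
  shows "wishart1 S (negate_component l v) $ i $ j =
    (if i = l then -1 else 1) * (if j = l then -1 else 1) * wishart1 S v $ i $ j"
  by (simp add: wishart1_nth[OF assms] negate_component_def)

text \<open>With \<open>D\<close> the diagonal matrix of the \<open>s i\<close>, \<open>B\<close> is
  \<open>D ** A ** D\<close> and \<open>D ** D\<close> is the identity, so inner signs cancel in
  every power.\<close>

lemma matrix_power_diagonal_conjugate:
  fixes A B :: "'a::comm_ring_1 ^ 'n ^ 'n"
  assumes B: "\<And>i j. B $ i $ j = s i * s j * A $ i $ j" and s: "\<And>i. s i * s i = 1"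
  shows "matrix_power B k $ i $ j = s i * s j * matrix_power A k $ i $ j"
proof (induction k arbitrary: i j)
  case 0
  show ?case by (simp add: mat_def s)
next
  case (Suc k)
  have "B $ i $ l * matrix_power B k $ l $ j = (s l * s l) * (s i * s j * (A $ i $ l * matrix_power A k $ l $ j))" for l
    by (simp add: B Suc mult_ac)
  then show ?case
    by (simp add: matrix_matrix_mult_def s sum_distrib_left)
qed

lemma diagonal_matrix_moment_wishart:
  fixes h :: "'i \<Rightarrow> 'a \<Rightarrow> complex ^ 'n"
  assumes M: "prob_space M" and I: "I \<noteq> {}"
    and \<Sigma>: "\<And>r. r \<in> I \<Longrightarrow> diagonal_covariance (\<Sigma> r)"
    and h: "\<And>r. r \<in> I \<Longrightarrow> iid_standard_complex_gaussian M (h r)"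
    and indep: "prob_space.indep_vars M (\<lambda>_. borel) h I"
  shows "diagonal_matrix (matrix_moment M (\<lambda>\<omega>. \<Sum>r\<in>I. wishart1 (\<Sigma> r) (h r \<omega>)) k)"
  unfolding diagonal_matrix_def
proof (intro allI impI)
  fix i j :: 'n assume ij: "i \<noteq> j"
  interpret prob_space M by fact
  \<comment> \<open>The integrand as a function of the whole family of vectors: its expectation
    depends only on their joint law.\<close>
  define G where "G x = matrix_power (\<Sum>r\<in>I. wishart1 (\<Sigma> r) (x r)) k $ i $ j" for x
  define h' where "h' r \<omega> = negate_component i (h r \<omega>)" for r \<omega>
  let ?P = "Pi\<^sub>M I (\<lambda>_. borel :: (complex ^ 'n) measure)"
  have h_meas [measurable]: "h r \<in> borel_measurable M" if "r \<in> I" for r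
    using iid_standard_complex_gaussian_borel_measurable h that by blast
  have h'_meas [measurable]: "h' r \<in> borel_measurable M" if "r \<in> I" for r
    unfolding h'_def using h_meas[OF that] borel_measurable_negate_component by (rule measurable_compose)
  have G_meas: "G \<in> borel_measurable ?P"
    unfolding G_def
  proof (rule borel_measurable_matrix_power_nth)
    fix i j
    have "(\<lambda>x. \<Sum>r\<in>I. wishart1 (\<Sigma> r) (x r) $ i $ j) \<in> borel_measurable ?P"
      by (intro borel_measurable_sum borel_measurable_wishart1_nth \<Sigma> measurable_component_singleton)
    then show "(\<lambda>x. (\<Sum>r\<in>I. wishart1 (\<Sigma> r) (x r)) $ i $ j) \<in> borel_measurable ?P"
      by (simp add: sum_component)
  qed
  have distr: "distr M ?P (\<lambda>\<omega>. \<lambda>r\<in>I. h' r \<omega>) = distr M ?P (\<lambda>\<omega>. \<lambda>r\<in>I. h r \<omega>)"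
  proof (rule indep_vars_distr_eq[OF I])
    show "indep_vars (\<lambda>_. borel) h' I"
      unfolding h'_def using indep borel_measurable_negate_component by (rule indep_vars_compose2)
    show "distr M borel (h' r) = distr M borel (h r)" if "r \<in> I" for r
      unfolding h'_def by (rule distr_negate_component) (rule h[OF that])
  qed fact
  \<comment> \<open>The joint law lives on functions restricted to \<open>I\<close>, and
    \<open>G\<close> reads its argument only there.\<close>
  have G_restrict: "G (\<lambda>r\<in>I. x r) = G x" for x
    unfolding G_def by (rule arg_cong[where f = "\<lambda>A. matrix_power A k $ i $ j"]) (rule sum.cong, auto)
  have G_h': "G (\<lambda>r. h' r \<omega>) = - G (\<lambda>r. h r \<omega>)" for \<omega>
  proof -
    \<comment> \<open>As \<open>j\<close> differs from \<open>i\<close>, exactly one of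
      \<open>s i\<close> and \<open>s j\<close> is -1.\<close>
    define s where "s l = (if l = i then -1 else 1 :: complex)" for l
    have "G (\<lambda>r. h' r \<omega>) = s i * s j * G (\<lambda>r. h r \<omega>)"
      unfolding G_def h'_def
      by (rule matrix_power_diagonal_conjugate)
         (auto simp: sum_component wishart1_negate_component[OF \<Sigma>] s_def sum_negf)
    then show ?thesis using ij by (simp add: s_def)
  qed
  have "(\<integral>\<omega>. G (\<lambda>r. h r \<omega>) \<partial>M) = (\<integral>x. G x \<partial>distr M ?P (\<lambda>\<omega>. \<lambda>r\<in>I. h r \<omega>))"
    by (subst integral_distr) (use G_meas in \<open>auto simp: G_restrict\<close>)
  also have "\<dots> = (\<integral>\<omega>. G (\<lambda>r. h' r \<omega>) \<partial>M)"
    unfolding distr [symmetric] by (subst integral_distr) (use G_meas in \<open>auto simp: G_restrict\<close>)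
  \<comment> \<open>The expectation equals its own negative.\<close>
  finally have "(\<integral>\<omega>. G (\<lambda>r. h r \<omega>) \<partial>M) = 0"
    by (simp add: G_h')
  then show "matrix_moment M (\<lambda>\<omega>. \<Sum>r\<in>I. wishart1 (\<Sigma> r) (h r \<omega>)) k $ i $ j = 0"
    by (simp add: matrix_moment_nth G_def)
qed

section \<open>The recursion for sums of Wishart matrices\<close>

theorem lemma3:
  fixes M :: "'a measure"
    and R n :: nat
    and \<Sigma> :: "nat \<Rightarrow> real ^ 't ^ 't"
    and h :: "nat \<Rightarrow> 'a \<Rightarrow> complex ^ 't"
    and W :: "'a \<Rightarrow> complex ^ 't ^ 't"
  assumes "prob_space M"
    and "R \<ge> 1"
    and "\<And>r. r \<in> {1..R} \<Longrightarrow> diagonal_covariance (\<Sigma> r)"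
    and "\<And>r. r \<in> {1..R} \<Longrightarrow> iid_standard_complex_gaussian M (h r)"
    and "prob_space.indep_vars M (\<lambda>_. borel) h {1..R}"
    and "W = (\<lambda>\<omega>. \<Sum>r=1..R. wishart1 (\<Sigma> r) (h r \<omega>))"
    and "n \<ge> 1"
  shows "diagonal_matrix (matrix_moment M W n) \<and>
    matrix_moment M W n =
      matrix_cumulant M W n +
      (\<Sum>l=1..n-1. real ((n - 1) choose (l - 1)) *\<^sub>R
         (matrix_cumulant M W l ** matrix_moment M W (n - l)))"
proof -
  interpret prob_space M by fact
  \<comment> \<open>The summand 1 keeps \<open>B\<close> positive even if every
    \<open>\<Sigma> r\<close> is zero; \<open>\<epsilon>\<close> below divides by it.\<close>
  define B where "B = 1 + (\<Sum>r=1..R. (\<Sum>i\<in>UNIV. sqrt (\<Sigma> r $ i $ i))\<^sup>2)"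
  define Y where "Y \<omega> = B * (\<Sum>r=1..R. (norm (h r \<omega>))\<^sup>2)" for \<omega>
  have B: "0 < B"
    unfolding B_def by (intro add_pos_nonneg sum_nonneg) auto
  have le_B: "(\<Sum>i\<in>UNIV. sqrt (\<Sigma> r $ i $ i))\<^sup>2 \<le> B" if "r \<in> {1..R}" for r
    unfolding B_def
    using member_le_sum[OF that, of "\<lambda>r. (\<Sum>i\<in>UNIV. sqrt (\<Sigma> r $ i $ i))\<^sup>2"] by simp
  have W_nth: "W \<omega> $ i $ j = (\<Sum>r=1..R. wishart1 (\<Sigma> r) (h r \<omega>) $ i $ j)" for \<omega> i j
    by (simp add: assms(6) sum_component)
  have meas: "(\<lambda>\<omega>. W \<omega> $ i $ j) \<in> borel_measurable M" for i j
    unfolding W_nth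
    by (intro borel_measurable_sum borel_measurable_wishart1_nth assms(3)
        iid_standard_complex_gaussian_borel_measurable assms(4))
  have bound: "norm (W \<omega> $ i $ j) \<le> Y \<omega>" for \<omega> i j
    unfolding W_nth Y_def sum_distrib_left
  proof (rule sum_norm_le)
    fix r assume r: "r \<in> {1..R}"
    show "norm (wishart1 (\<Sigma> r) (h r \<omega>) $ i $ j) \<le> B * (norm (h r \<omega>))\<^sup>2"
      by (rule order_trans[OF norm_wishart1_nth_le[OF assms(3)[OF r]] mult_right_mono[OF le_B[OF r]]]) simp
  qed
  obtain c where c: "0 < c" "integrable M (\<lambda>\<omega>. exp (c * (\<Sum>r=1..R. (norm (h r \<omega>))\<^sup>2)))"
  proof (rule integrable_exp_sum_norm_square[OF assms(1), of "{1..R}" h])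
    show "{1..R} \<noteq> {}" using assms(2) by simp
  qed (use assms(4) in auto)
  \<comment> \<open>Chosen so that \<open>\<epsilon> * (real CARD('t) * Y \<omega>)\<close> is
    \<open>c\<close> times the sum of squared norms.\<close>
  define \<epsilon> where "\<epsilon> = c / (real CARD('t) * B)"
  have \<epsilon>: "0 < \<epsilon>" "integrable M (\<lambda>\<omega>. exp (\<epsilon> * (real CARD('t) * Y \<omega>)))"
    using c B by (simp_all add: \<epsilon>_def Y_def)
  \<comment> \<open>Every order is covered, not only \<open>n\<close>: the whole moment series must
    have zero off-diagonal entries.\<close>
  have diag: "diagonal_matrix (matrix_moment M W k)" for k
    unfolding assms(6)
    by (rule diagonal_matrix_moment_wishart) (use assms(1-5) in auto)
  show ?thesis
    using diag matrix_moment_cumulant_recursion[OF assms(1) meas bound \<epsilon> diag assms(7)] by blast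
qed

end
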